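(* Let $B, C, D$ be integers and let $t, u$ be relatively prime integers. If an integer $A$ is a divisor of $Bt^2 + Ctu + Du^2$, then there exist integers $L, M, N$ and relatively prime integers $s, x$ such that $$A = Ls^2 + Msx + Nx^2 \quad\text{and}\quad 4LN - M^2 = 4BD - C^2.$$
   Context: All letters denote integers (positive, negative or zero). *)

theory Defs
  imports Main
begin

end

theory Submission imports Defs begin

text \<open>
  A form represents a number \<open>m\<close> properly, at \<open>(t, u)\<close>, exactly when a unimodular change of
  variables turns it into a form with leading coefficient \<open>m\<close>: since \<open>t\<close> and \<open>u\<close> are coprime,
  \<open>(t, u)\<close> is the first vector of a basis \<open>(t, u), (v, w)\<close> of the lattice of integer pairs with
  determinant \<open>t w - u v = 1\<close>, and the discriminant is preserved. If \<open>m = A k\<close>, the new form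
  is \<open>A k X\<^sup>2 + M X Y + c Y\<^sup>2\<close>. Its discriminant depends on the outer coefficients only through
  their product, so the factor \<open>k\<close> can be moved from the first to the last: the form
  \<open>A X\<^sup>2 + M X Y + k c Y\<^sup>2\<close> has the same discriminant, and it takes the value \<open>A\<close> at the
  coprime pair \<open>(1, 0)\<close>.
\<close>

text \<open>
  The negated discriminant is the determinant of the symmetric matrix with rows \<open>(2 B, C)\<close> and
  \<open>(C, 2 D)\<close>. A linear substitution multiplies this matrix by its own matrix on one side and by
  the transpose on the other, which contributes the square of the determinant.
\<close>

lemma discriminant_linear_substitution:
  fixes B C D t u v w :: "'a :: comm_ring_1"
  shows "4 * (B * t\<^sup>2 + C * t * u + D * u\<^sup>2) * (B * v\<^sup>2 + C * v * w + D * w\<^sup>2)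
           - (2 * B * t * v + C * (t * w + u * v) + 2 * D * u * w)\<^sup>2
         = (4 * B * D - C\<^sup>2) * (t * w - u * v)\<^sup>2"
  by (simp add: power2_eq_square algebra_simps)

theorem theoremI:
  fixes A B C D t u :: int
  assumes "coprime t u"
    and "A dvd B * t\<^sup>2 + C * t * u + D * u\<^sup>2"
  shows "\<exists>L M N s x :: int. coprime s x
           \<and> A = L * s\<^sup>2 + M * s * x + N * x\<^sup>2
           \<and> 4 * L * N - M\<^sup>2 = 4 * B * D - C\<^sup>2"
proof -
  from assms(2) obtain k where k: "B * t\<^sup>2 + C * t * u + D * u\<^sup>2 = A * k" ..
  obtain p q where "p * t + q * u = 1"
    using bezout_int[of t u] assms(1) by auto
  then have det: "t * p - u * (- q) = 1"
    by (simp add: algebra_simps)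
  define M where "M = 2 * B * t * (- q) + C * (t * p + u * (- q)) + 2 * D * u * p"
  define c where "c = B * (- q)\<^sup>2 + C * (- q) * p + D * p\<^sup>2"
  have "4 * (A * k) * c - M\<^sup>2 = 4 * B * D - C\<^sup>2"
    using discriminant_linear_substitution[of B t C u D "- q" p]
    unfolding k det M_def c_def by simp
  then have "4 * A * (k * c) - M\<^sup>2 = 4 * B * D - C\<^sup>2"
    by (simp add: mult.assoc)
  moreover have "A = A * 1\<^sup>2 + M * 1 * 0 + k * c * 0\<^sup>2"
    by simp
  moreover have "coprime (1 :: int) 0"
    by simp
  ultimately show ?thesis
    by blast
qed

end
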